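(* Let $\mathcal{A}$ be a (randomized) algorithm that solves the wake-up problem in $f(n)$ rounds, in expectation, in the radio network model with a single channel and collision detection (that is, for every network size $n$ and every non-empty set of activated nodes, the expected number of rounds until the problem is solved is at most $f(n)$). Then $f(n)\in\Omega(\log\log n)$.
   Context: Radio network model (single hop, single channel, with collision detection): there are $n$ nodes with unique ids from $[n]=\{1,\dots,n\}$, every two of which are neighbors. Executions proceed in synchronous rounds. In each round each node either transmits a message or receives. A node $u$ receives a message from $v$ in a round if and only if $u$ is receiving, $v$ is transmitting, and $v$ is the only neighbor of $u$ transmitting in that round. Collision detection: a receiving node can distinguish between silence (no neighbor transmits) and collision (two or more neighbors transmit); moreover a transmitting node can distinguish between transmitting alone and transmitting simultaneously with one or more other nodes. Wake-up problem: all nodes are initially inactive; at the beginning of the execution an adversary activates an arbitrary non-empty subset of the nodes. Inactive nodes can only listen (detecting a collision does not wake them up); active nodes execute an arbitrary randomized algorithm and have no advance knowledge of the identities of the other active nodes. The problem is solved in the first round in which exactly one active node transmits (an active node broadcasts alone). Asymptotics are as $n\to\infty$. *)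

theory Defs
  imports "HOL-Probability.Probability" "HOL-Library.Landau_Symbols"
begin

section \<open>Single-hop, single-channel radio network with collision detection\<close>

datatype 'm action = Transmit (content: 'm) | Receive

abbreviation transmits :: "'m action \<Rightarrow> bool" where
  "transmits a \<equiv> a \<noteq> Receive"

datatype 'm feedback =
    Alone \<comment> \<open>own transmission, no other node transmitted\<close>
  | Simultaneous \<comment> \<open>own transmission, at least one other node transmitted\<close>
  | Silence
  | Received 'm
  | Collision

definition neighbors :: "nat \<Rightarrow> nat \<Rightarrow> nat set" where
  "neighbors n u = {1..n} - {u}"

definition feedback_of :: "nat \<Rightarrow> (nat \<Rightarrow> 'm action) \<Rightarrow> nat \<Rightarrow> 'm feedback" where
  "feedback_of n a u =
    (let T = {v \<in> neighbors n u. transmits (a v)} in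
     case a u of
       Transmit _ \<Rightarrow> (if T = {} then Alone else Simultaneous)
     | Receive \<Rightarrow>
         (if T = {} then Silence
          else if card T = 1 then Received (content (a (the_elem T)))
          else Collision))"

section \<open>Randomized algorithms\<close>

text \<open>
  For network size \<open>n\<close>, node \<open>u\<close> draws a private seed from the probability space \<open>coins n u\<close>
  before the first round; afterwards its action is a function of \<open>n\<close>, its id, the seed and the
  feedback of all earlier rounds (oldest first). Fresh randomness in every round is covered by
  seeds that are sequences, and earlier actions of the node itself can be recomputed from the
  seed and the feedback.
\<close>

record ('r, 'm) radio_algorithm =
  coins :: "nat \<Rightarrow> nat \<Rightarrow> 'r measure"
  act :: "nat \<Rightarrow> nat \<Rightarrow> 'r \<Rightarrow> 'm feedback list \<Rightarrow> 'm action"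

text \<open>
  Only the decision whether to transmit has to be measurable: before the first round with a
  lone transmitter no message content is ever received, so the contents do not influence the
  number of rounds.
\<close>

definition randomized_algorithm :: "('r, 'm) radio_algorithm \<Rightarrow> bool" where
  "randomized_algorithm A \<longleftrightarrow>
    (\<forall>n. \<forall>u\<in>{1..n}. prob_space (coins A n u) \<and>
      (\<forall>h. {r \<in> space (coins A n u). transmits (act A n u r h)} \<in> sets (coins A n u)))"

section \<open>Executions and the wake-up problem\<close>

text \<open>\<open>S\<close> is the set of activated nodes and \<open>\<omega>\<close> assigns its seed to every activated node.
  All other nodes listen in every round; since only the rounds up to the first lone transmission
  matter, no node has to be activated later.\<close>

definition actions ::
  "('r, 'm) radio_algorithm \<Rightarrow> nat \<Rightarrow> nat set \<Rightarrow> (nat \<Rightarrow> 'r) \<Rightarrow>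
    (nat \<Rightarrow> 'm feedback list) \<Rightarrow> nat \<Rightarrow> 'm action" where
  "actions A n S \<omega> h u = (if u \<in> S then act A n u (\<omega> u) (h u) else Receive)"

primrec history ::
  "('r, 'm) radio_algorithm \<Rightarrow> nat \<Rightarrow> nat set \<Rightarrow> (nat \<Rightarrow> 'r) \<Rightarrow>
    nat \<Rightarrow> nat \<Rightarrow> 'm feedback list" where
  "history A n S \<omega> 0 = (\<lambda>u. [])"
| "history A n S \<omega> (Suc t) =
    (\<lambda>u. history A n S \<omega> t u @ [feedback_of n (actions A n S \<omega> (history A n S \<omega> t)) u])"

text \<open>Rounds are indexed from \<open>0\<close>, so \<open>t\<close> rounds precede round \<open>t\<close>.\<close>

definition solved_in_round ::
  "('r, 'm) radio_algorithm \<Rightarrow> nat \<Rightarrow> nat set \<Rightarrow> (nat \<Rightarrow> 'r) \<Rightarrow> nat \<Rightarrow> bool" where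
  "solved_in_round A n S \<omega> t \<longleftrightarrow>
    (\<exists>!u. u \<in> S \<and> transmits (actions A n S \<omega> (history A n S \<omega> t) u))"

definition rounds_until_solved ::
  "('r, 'm) radio_algorithm \<Rightarrow> nat \<Rightarrow> nat set \<Rightarrow> (nat \<Rightarrow> 'r) \<Rightarrow> ennreal" where
  "rounds_until_solved A n S \<omega> =
    (if \<exists>t. solved_in_round A n S \<omega> t
     then of_nat (Suc (LEAST t. solved_in_round A n S \<omega> t)) else \<infinity>)"

text \<open>The product measure makes the seeds of the activated nodes independent.\<close>

definition expected_rounds :: "('r, 'm) radio_algorithm \<Rightarrow> nat \<Rightarrow> nat set \<Rightarrow> ennreal" where
  "expected_rounds A n S =
    (\<integral>\<^sup>+ \<omega>. rounds_until_solved A n S \<omega> \<partial>(\<Pi>\<^sub>M u\<in>S. coins A n u))"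

definition solves_wakeup_in_expectation ::
  "('r, 'm) radio_algorithm \<Rightarrow> (nat \<Rightarrow> real) \<Rightarrow> bool" where
  "solves_wakeup_in_expectation A f \<longleftrightarrow>
    (\<forall>n S. S \<subseteq> {1..n} \<and> S \<noteq> {} \<longrightarrow> expected_rounds A n S \<le> ennreal (f n))"

end

theory Submission
  imports Defs "HOL-Real_Asymp.Real_Asymp"
begin

text \<open>Until some node transmits alone, all active nodes see the same sequence of silences and
  collisions. Once the seeds are fixed, each such sequence determines which nodes would transmit
  next, so solving the problem in the first \<open>t\<close> rounds means that the activated set meets one of
  fewer than \<open>2 ^ t\<close> fixed sets in exactly one node. Give a nonempty set \<open>S\<close> of nodes the weight
  \<open>1 / (k * (n choose k))\<close>, where \<open>k = card S\<close>. The total weight is the \<open>n\<close>-th harmonic number,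
  but the sets meeting a given set in exactly one node have weight at most \<open>1\<close>. Averaging
  over the seeds, some activated set fails with probability at least \<open>1 / 2\<close> during the first
  \<open>t\<close> rounds if \<open>2 * 2 ^ t \<le> harm n\<close>, that is, for some \<open>t\<close> of order \<open>log (log n)\<close>.\<close>

section \<open>Binomial sums and the weighting of node sets\<close>

lemma sum_Pow_card:
  fixes g :: "nat \<Rightarrow> real"
  assumes "finite B"
  shows "(\<Sum>S\<in>Pow B. g (card S)) = (\<Sum>j\<le>card B. real (card B choose j) * g j)"
proof -
  have "(\<Sum>S\<in>Pow B. g (card S)) = (\<Sum>j\<le>card B. \<Sum>S | S \<in> Pow B \<and> card S = j. g (card S))"
    by (rule sum.group [symmetric]) (use assms in \<open>auto intro: card_mono\<close>)
  also have "\<dots> = (\<Sum>j\<le>card B. real (card B choose j) * g j)"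
    using assms by (intro sum.cong) (simp_all add: n_subsets)
  finally show ?thesis .
qed

text \<open>Absorption, \<open>Suc j * (Suc a choose Suc j) = Suc a * (a choose j)\<close>, applied
  to numerator and denominator, pulls out \<open>(a + 1) / (N' + 1)\<close> and leaves the same sum
  for \<open>a\<close> and \<open>N'\<close>; the term for \<open>j = 0\<close> adds 1.\<close>

lemma sum_binomial_quotients:
  assumes "a \<le> N"
  shows "(\<Sum>j\<le>a. real (a choose j) / real (N choose j)) = (real N + 1) / (real N + 1 - real a)"
  using assms
proof (induction a arbitrary: N)
  case (Suc a)
  then obtain N' where N: "N = Suc N'" and "a \<le> N'"
    by (cases N) auto
  have "real (Suc a choose Suc j) / real (Suc N' choose Suc j) =
      (real a + 1) / (real N' + 1) * (real (a choose j) / real (N' choose j))" for j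
  proof -
    have "real (Suc j) * real (Suc a choose Suc j) = real (Suc a) * real (a choose j)"
         "real (Suc j) * real (Suc N' choose Suc j) = real (Suc N') * real (N' choose j)"
      by (metis Suc_times_binomial_eq of_nat_mult mult.commute)+
    then have "real (Suc a choose Suc j) = real (Suc a) * real (a choose j) / real (Suc j)"
         "real (Suc N' choose Suc j) = real (Suc N') * real (N' choose j) / real (Suc j)"
      by (simp_all add: field_simps del: binomial_Suc_Suc)
    then show ?thesis
      by (simp add: add.commute del: binomial_Suc_Suc)
  qed
  then have eq: "(\<Sum>j\<le>Suc a. real (Suc a choose j) / real (N choose j)) =
      1 + (real a + 1) / (real N' + 1) * (\<Sum>j\<le>a. real (a choose j) / real (N' choose j))"
    unfolding N by (subst sum.atMost_Suc_shift)
      (simp add: sum_distrib_left del: binomial_Suc_Suc)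
  obtain d where "N' = a + d"
    using \<open>a \<le> N'\<close> le_Suc_ex by blast
  then show ?case
    unfolding eq Suc.IH [OF \<open>a \<le> N'\<close>] by (simp add: N add_divide_eq_iff add_ac)
qed simp

text \<open>Division by zero makes the weight of the empty set \<open>0\<close>.\<close>

definition subset_weight :: "nat \<Rightarrow> 'a set \<Rightarrow> real" where
  "subset_weight n S = 1 / (real (card S) * real (n choose card S))"

lemma subset_weight_nonneg: "0 \<le> subset_weight n S"
  by (simp add: subset_weight_def)

text \<open>For each positive \<open>j \<le> card B\<close>, the sets of size \<open>j\<close> share
  total weight \<open>1 / j\<close>.\<close>

lemma sum_subset_weight:
  assumes "finite B"
  shows "(\<Sum>S\<in>Pow B. subset_weight (card B) S) = harm (card B)"
proof -
  have "(\<Sum>S\<in>Pow B. subset_weight (card B) S) =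
      (\<Sum>j\<le>card B. real (card B choose j) * (1 / (real j * real (card B choose j))))"
    unfolding subset_weight_def by (rule sum_Pow_card [OF assms])
  also have "\<dots> = (\<Sum>j\<in>{1..card B}. inverse (real j))"
    by (rule sum.mono_neutral_cong_right) (auto simp: field_simps)
  finally show ?thesis
    by (simp add: harm_def)
qed

text \<open>Such a set is uniquely \<open>insert u S\<close> with \<open>u\<close> in
  \<open>T\<close> and \<open>S\<close> disjoint from \<open>T\<close>. Its weight does not depend
  on \<open>u\<close>, so for nonempty \<open>T\<close> the sum is \<open>card T / card B\<close>
  times a sum of binomial quotients equal to \<open>card B / card T\<close>, hence exactly
  1.\<close>

lemma sum_subset_weight_hit_once:
  assumes "finite B" and "T \<subseteq> B"
  shows "(\<Sum>S | S \<subseteq> B \<and> card (S \<inter> T) = 1. subset_weight (card B) S) \<le> 1"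
proof (cases "T = {}")
  case False
  have [simp]: "finite T"
    using assms finite_subset by blast
  define N where "N = card B - 1"
  have "0 < card T"
    using False by (simp add: card_gt_0_iff)
  have le: "card T \<le> card B"
    using assms by (simp add: card_mono)
  have B: "card B = Suc N"
    using le \<open>0 < card T\<close> by (simp add: N_def)
  have dT: "card (B - T) = Suc N - card T"
    using assms B by (simp add: card_Diff_subset)
  \<comment> \<open>The factor \<open>k\<close> in the weight of a set of size \<open>k\<close> is
    absorbed here: \<open>k * (Suc N choose k) = Suc N * (N choose (k - 1))\<close>.\<close>
  have w: "subset_weight (card B) (insert u S) = 1 / (real (Suc N) * real (N choose card S))"
    if "u \<in> T" "S \<subseteq> B - T" for u S
  proof -
    have "finite S"
      using that assms by (metis finite_Diff finite_subset)
    moreover have "u \<notin> S"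
      using that by auto
    ultimately have "card (insert u S) = Suc (card S)"
      by simp
    moreover have "real (Suc (card S)) * real (Suc N choose Suc (card S)) =
        real (Suc N) * real (N choose card S)"
      by (metis Suc_times_binomial_eq of_nat_mult mult.commute)
    ultimately show ?thesis
      unfolding subset_weight_def B by simp
  qed
  have "(\<Sum>S | S \<subseteq> B \<and> card (S \<inter> T) = 1. subset_weight (card B) S) =
      (\<Sum>(u, S)\<in>T \<times> Pow (B - T). subset_weight (card B) (insert u S))"
  proof (rule sum.reindex_bij_witness
      [where i = "\<lambda>(u, S). insert u S" and j = "\<lambda>S. (the_elem (S \<inter> T), S - T)"])
    fix S assume S: "S \<in> {S. S \<subseteq> B \<and> card (S \<inter> T) = 1}"
    then obtain u where "S \<inter> T = {u}"
      by (auto simp: card_1_singleton_iff)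
    with S show "(case (the_elem (S \<inter> T), S - T) of (u, S) \<Rightarrow> insert u S) = S"
      and "(the_elem (S \<inter> T), S - T) \<in> T \<times> Pow (B - T)"
      and "(case (the_elem (S \<inter> T), S - T) of (u, S) \<Rightarrow> subset_weight (card B) (insert u S)) =
        subset_weight (card B) S"
      by (auto intro!: arg_cong [where f = "subset_weight _"])
  next
    fix p assume p: "p \<in> T \<times> Pow (B - T)"
    then obtain u S where us: "p = (u, S)" "u \<in> T" "S \<subseteq> B - T"
      by auto
    then have "insert u S \<inter> T = {u}" and "insert u S - T = S"
      by auto
    then have "the_elem (insert u S \<inter> T) = u" and "card (insert u S \<inter> T) = 1"
      and "insert u S - T = S"
      by (simp_all del: Int_insert_left)
    with us assms(2) show "(the_elem ((case p of (u, S) \<Rightarrow> insert u S) \<inter> T),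
          (case p of (u, S) \<Rightarrow> insert u S) - T) = p"
      and "(case p of (u, S) \<Rightarrow> insert u S) \<in> {S. S \<subseteq> B \<and> card (S \<inter> T) = 1}"
      by (auto simp del: Int_insert_left)
  qed
  also have "\<dots> = (\<Sum>u\<in>T. \<Sum>S\<in>Pow (B - T). 1 / (real (Suc N) * real (N choose card S)))"
    unfolding sum.cartesian_product [symmetric] by (intro sum.cong refl w) auto
  also have "\<dots> = real (card T) / real (Suc N) *
      (\<Sum>j\<le>card (B - T). real (card (B - T) choose j) / real (N choose j))"
    using assms sum_Pow_card [of "B - T" "\<lambda>j. 1 / (real (Suc N) * real (N choose j))"]
    by (simp add: sum_distrib_left mult.commute)
  \<comment> \<open>Since \<open>T\<close> is nonempty, \<open>card (B - T) \<le> N\<close>, and the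
    denominator of the closed form is \<open>card T\<close>.\<close>
  also have "\<dots> = 1"
    using \<open>0 < card T\<close> le unfolding dT B
    by (subst sum_binomial_quotients) (auto simp: of_nat_diff)
  finally show ?thesis
    by simp
qed simp

section \<open>Executions before the first lone transmission\<close>

text \<open>As long as no node has transmitted alone, every active node learns in each round only
  whether there was a collision (\<open>True\<close>) or silence (\<open>False\<close>). The lists of these
  outcomes have the latest round first.\<close>

primrec outcome_history ::
  "('r, 'm) radio_algorithm \<Rightarrow> nat \<Rightarrow> nat \<Rightarrow> 'r \<Rightarrow> bool list \<Rightarrow> 'm feedback list" where
  "outcome_history A n u r [] = []"
| "outcome_history A n u r (c # cs) = outcome_history A n u r cs @
    [if \<not> c then Silence
     else if transmits (act A n u r (outcome_history A n u r cs)) then Simultaneous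
     else Collision]"

definition transmits_after ::
  "('r, 'm) radio_algorithm \<Rightarrow> nat \<Rightarrow> nat \<Rightarrow> bool list \<Rightarrow> 'r \<Rightarrow> bool" where
  "transmits_after A n u cs r \<longleftrightarrow> transmits (act A n u r (outcome_history A n u r cs))"

text \<open>All outcome sequences count, not just the one that occurs. This enlarges the event of
  being solved in the first \<open>t\<close> rounds (round \<open>s\<close> follows \<open>s\<close>
  outcomes), but makes the sets to be met depend on the seeds alone and not on
  \<open>S\<close>.\<close>

definition hit_once ::
  "('r, 'm) radio_algorithm \<Rightarrow> nat \<Rightarrow> nat \<Rightarrow> nat set \<Rightarrow> (nat \<Rightarrow> 'r) \<Rightarrow> bool" where
  "hit_once A n t S \<omega> \<longleftrightarrow>
    (\<exists>cs\<in>{cs. length cs < t}. \<exists>!u. u \<in> S \<and> transmits_after A n u cs (\<omega> u))"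

text \<open>An unsolved round has no transmitter or at least two. A transmitter then hears
  \<open>Simultaneous\<close> and a listener \<open>Silence\<close> or \<open>Collision\<close>,
  never a message, so one shared bit per round and the own seed determine each history.\<close>

lemma history_eq_outcome_history:
  assumes S: "S \<subseteq> {1..n}" and "\<And>s. s < t \<Longrightarrow> \<not> solved_in_round A n S \<omega> s"
  shows "\<exists>cs. length cs = t \<and>
    (\<forall>u\<in>S. history A n S \<omega> t u = outcome_history A n u (\<omega> u) cs)"
  using assms(2)
proof (induction t)
  case (Suc t)
  then obtain cs where cs: "length cs = t"
    "\<And>u. u \<in> S \<Longrightarrow> history A n S \<omega> t u = outcome_history A n u (\<omega> u) cs"
    by auto
  define a where "a = actions A n S \<omega> (history A n S \<omega> t)"
  define X where "X = {u \<in> {1..n}. transmits (a u)}"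
  have X_S: "X \<subseteq> S"
    by (auto simp: X_def a_def actions_def split: if_splits)
  have a: "transmits (a u) \<longleftrightarrow> transmits (act A n u (\<omega> u) (outcome_history A n u (\<omega> u) cs))"
    if "u \<in> S" for u
    using that cs by (simp add: a_def actions_def)
  have "\<not> (\<exists>!u. u \<in> S \<and> transmits (a u))"
    using Suc.prems [of t] by (simp add: solved_in_round_def a_def)
  moreover have "X = {u \<in> S. transmits (a u)}"
    using X_S S by (auto simp: X_def)
  ultimately have not1: "X \<noteq> {u}" for u
    by (metis (mono_tags, lifting) mem_Collect_eq singletonD singletonI)
  have nb: "{v \<in> neighbors n u. transmits (a v)} = X - {u}" for u
    by (auto simp: X_def neighbors_def)
  have "feedback_of n a u = (if X = {} then Silence
     else if transmits (act A n u (\<omega> u) (outcome_history A n u (\<omega> u) cs)) then Simultaneous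
     else Collision)" if u: "u \<in> S" for u
  proof (cases "transmits (a u)")
    case True
    then have "u \<in> X"
      using u S by (auto simp: X_def)
    moreover have "X - {u} \<noteq> {}"
      using not1 [of u] \<open>u \<in> X\<close> by auto
    moreover have "transmits (act A n u (\<omega> u) (outcome_history A n u (\<omega> u) cs))"
      using True a u by blast
    ultimately show ?thesis
      using True unfolding feedback_of_def nb by (cases "a u") auto
  next
    case False
    then have "X - {u} = X"
      by (auto simp: X_def)
    moreover have "card X \<noteq> 1"
      using not1 by (auto simp: card_1_singleton_iff)
    moreover have "\<not> transmits (act A n u (\<omega> u) (outcome_history A n u (\<omega> u) cs))"
      using False a u by blast
    ultimately show ?thesis
      using False unfolding feedback_of_def nb by auto
  qed
  then have "\<forall>u\<in>S. history A n S \<omega> (Suc t) u = outcome_history A n u (\<omega> u) ((X \<noteq> {}) # cs)"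
    using cs by (simp add: a_def [symmetric])
  with cs(1) show ?case
    by (intro exI [of _ "(X \<noteq> {}) # cs"]) auto
qed simp

text \<open>If \<open>s\<close> is the first solved round, its histories come from an outcome
  sequence of length \<open>s\<close>, and the lone transmitter yields a hit unless
  \<open>t \<le> s\<close>.\<close>

lemma rounds_until_solved_ge:
  assumes "S \<subseteq> {1..n}" and "\<not> hit_once A n t S \<omega>"
  shows "of_nat (Suc t) \<le> rounds_until_solved A n S \<omega>"
proof (cases "\<exists>s. solved_in_round A n S \<omega> s")
  case True
  define s where "s = (LEAST s. solved_in_round A n S \<omega> s)"
  have s: "solved_in_round A n S \<omega> s" "\<And>s'. s' < s \<Longrightarrow> \<not> solved_in_round A n S \<omega> s'"
    using True not_less_Least unfolding s_def by (auto intro: LeastI)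
  obtain cs where cs: "length cs = s"
    "\<And>u. u \<in> S \<Longrightarrow> history A n S \<omega> s u = outcome_history A n u (\<omega> u) cs"
    using history_eq_outcome_history [OF assms(1) s(2)] by blast
  have "(u \<in> S \<and> transmits (actions A n S \<omega> (history A n S \<omega> s) u)) =
      (u \<in> S \<and> transmits_after A n u cs (\<omega> u))" for u
    using cs(2) [of u] by (cases "u \<in> S") (simp_all add: actions_def transmits_after_def)
  then have "\<exists>!u. u \<in> S \<and> transmits_after A n u cs (\<omega> u)"
    using s(1) unfolding solved_in_round_def by simp
  then have "t \<le> s"
    using assms(2) cs(1) by (force simp only: hit_once_def not_le [symmetric] mem_Collect_eq)
  then show ?thesis
    using True by (simp add: rounds_until_solved_def s_def [symmetric])
qed (simp add: rounds_until_solved_def)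

section \<open>Counting outcome sequences for fixed seeds\<close>

lemma finite_bool_lists: "finite {cs :: bool list. length cs < t}"
  and card_bool_lists: "card {cs :: bool list. length cs < t} \<le> 2 ^ t"
proof (induction t)
  case (Suc t)
  have eq: "{cs :: bool list. length cs < Suc t} =
      {cs. length cs < t} \<union> {cs. set cs \<subseteq> UNIV \<and> length cs = t}"
    by auto
  case 1
  show ?case
    unfolding eq by (intro finite_UnI Suc finite_lists_length_eq) auto
  case 2
  have "card {cs :: bool list. length cs < Suc t} \<le> 2 ^ t + 2 ^ t"
    unfolding eq using Suc(2) card_lists_length_eq [of "UNIV :: bool set" t]
    by (intro order.trans [OF card_Un_le] add_mono) simp_all
  then show ?case
    by simp
qed simp_all

text \<open>Union bound: each outcome sequence fixes a set \<open>T cs\<close> independent of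
  \<open>S\<close>, and the sets meeting it exactly once weigh at most 1 in total.\<close>

lemma sum_subset_weight_hit_once_le:
  "(\<Sum>S\<in>Pow {1..n}. subset_weight n S * of_bool (hit_once A n t S \<omega>)) \<le> 2 ^ t"
proof -
  define T where "T cs = {u \<in> {1..n}. transmits_after A n u cs (\<omega> u)}" for cs
  have "of_bool (hit_once A n t S \<omega>) \<le> (\<Sum>cs | length cs < t. of_bool (card (S \<inter> T cs) = 1) :: real)"
    if S: "S \<subseteq> {1..n}" for S
  proof (cases "hit_once A n t S \<omega>")
    case True
    then obtain cs where cs: "length cs < t" "\<exists>!u. u \<in> S \<and> transmits_after A n u cs (\<omega> u)"
      by (auto simp: hit_once_def)
    moreover have "S \<inter> T cs = {u \<in> S. transmits_after A n u cs (\<omega> u)}"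
      using S by (auto simp: T_def)
    ultimately have "card (S \<inter> T cs) = 1"
      by (auto simp: card_1_singleton_iff set_eq_iff)
    then show ?thesis
      using member_le_sum [of cs "{cs. length cs < t}" "\<lambda>cs. of_bool (card (S \<inter> T cs) = 1) :: real"]
        cs(1) finite_bool_lists True by simp
  qed (simp add: sum_nonneg)
  then have "(\<Sum>S\<in>Pow {1..n}. subset_weight n S * of_bool (hit_once A n t S \<omega>)) \<le>
      (\<Sum>S\<in>Pow {1..n}. subset_weight n S * (\<Sum>cs | length cs < t. of_bool (card (S \<inter> T cs) = 1)))"
    by (intro sum_mono mult_left_mono) (auto simp: subset_weight_nonneg)
  also have "\<dots> = (\<Sum>cs | length cs < t. \<Sum>S\<in>Pow {1..n}.
      subset_weight n S * of_bool (card (S \<inter> T cs) = 1))"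
    unfolding sum_distrib_left by (rule sum.swap)
  also have "\<dots> \<le> (\<Sum>cs :: bool list | length cs < t. 1)"
  proof (intro sum_mono)
    fix cs
    have "(\<Sum>S\<in>Pow {1..n}. subset_weight n S * of_bool (card (S \<inter> T cs) = 1)) =
        (\<Sum>S | S \<subseteq> {1..n} \<and> card (S \<inter> T cs) = 1. subset_weight n S)"
      by (rule sum.mono_neutral_cong_right) auto
    also have "\<dots> \<le> 1"
      proof -
      have "T cs \<subseteq> {1..n}"
        by (auto simp: T_def)
      from sum_subset_weight_hit_once [OF _ this] show ?thesis
        by simp
    qed
    finally show "(\<Sum>S\<in>Pow {1..n}. subset_weight n S * of_bool (card (S \<inter> T cs) = 1)) \<le> 1" .
  qed
  also have "\<dots> \<le> 2 ^ t"
    using card_bool_lists [of t, THEN of_nat_mono, where 'a = real] by simp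
  finally show ?thesis .
qed

section \<open>Measurability\<close>

text \<open>The decision is assumed measurable for each fixed history, but here the history depends
  on the seed. It takes finitely many values, as no message content occurs in it, so the event
  splits into finitely many cases.\<close>

lemma measurable_transmits_after:
  assumes A: "randomized_algorithm A" and u: "u \<in> {1..n}"
  shows "Measurable.pred (coins A n u) (transmits_after A n u cs)"
proof -
  let ?M = "coins A n u"
  have tr: "Measurable.pred ?M (\<lambda>r. transmits (act A n u r h))" for h
    using A u by (auto simp: randomized_algorithm_def pred_def)
  define H where "H cs = {h :: 'b feedback list. set h \<subseteq> {Silence, Simultaneous, Collision} \<and>
    length h = length cs}" for cs :: "bool list"
  have fin: "finite (H cs)" for cs
    unfolding H_def by (intro finite_lists_length_eq) auto
  have oh: "outcome_history A n u r cs \<in> H cs" for r cs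
    by (induction cs) (auto simp: H_def)
  have after: "transmits_after A n u cs = (\<lambda>r. \<exists>h\<in>H cs. outcome_history A n u r cs = h \<and>
      transmits (act A n u r h))" for cs
    using oh by (auto simp: transmits_after_def)
  have step: "Measurable.pred ?M (transmits_after A n u cs)"
    if "\<And>h. Measurable.pred ?M (\<lambda>r. outcome_history A n u r cs = h)" for cs
    unfolding after by (intro pred_intros_finite pred_intros_logic fin that tr)
  have "Measurable.pred ?M (\<lambda>r. outcome_history A n u r cs = h)" for h
  proof (induction cs arbitrary: h)
    case (Cons c cs)
    have [measurable]: "Measurable.pred ?M (\<lambda>r. outcome_history A n u r cs = h)" for h
      by (rule Cons.IH)
    have [measurable]: "Measurable.pred ?M (transmits_after A n u cs)"
      by (rule step) measurable
    \<comment> \<open>\<open>last\<close> isolates the newest feedback, which depends only on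
      \<open>c\<close> and on whether the node transmits; \<open>butlast\<close> leaves the history
      covered by the induction hypothesis.\<close>
    have "(\<lambda>r. outcome_history A n u r (c # cs) = h) = (\<lambda>r. h \<noteq> [] \<and>
        outcome_history A n u r cs = butlast h \<and>
        (if \<not> c then last h = Silence
         else if transmits_after A n u cs r then last h = Simultaneous
         else last h = Collision))"
      by (cases h rule: rev_cases) (auto simp: transmits_after_def)
    then show ?case
      by simp measurable
  qed simp
  then show ?thesis
    by (rule step)
qed

text \<open>\<open>I\<close> will be \<open>S\<close> for the expected number of rounds and
  \<open>{1..n}\<close> for the averaging over all \<open>S\<close>.\<close>

lemma measurable_hit_once:
  assumes A: "randomized_algorithm A" and "S \<subseteq> I" and "I \<subseteq> {1..n}"
  shows "Measurable.pred (Pi\<^sub>M I (coins A n)) (hit_once A n t S)"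
proof -
  have [measurable]: "Measurable.pred (Pi\<^sub>M I (coins A n)) (\<lambda>\<omega>. transmits_after A n u cs (\<omega> u))"
    if "u \<in> S" for u cs
  proof (rule measurable_compose [OF measurable_component_singleton])
    show "u \<in> I"
      using that assms by auto
    show "Measurable.pred (coins A n u) (transmits_after A n u cs)"
      using that assms by (intro measurable_transmits_after) auto
  qed
  have "finite S"
    using assms finite_subset by (metis finite_atLeastAtMost)
  have "hit_once A n t S = (\<lambda>\<omega>. \<exists>cs\<in>{cs. length cs < t}. \<exists>u\<in>S. transmits_after A n u cs (\<omega> u) \<and>
      (\<forall>v\<in>S. transmits_after A n v cs (\<omega> v) \<longrightarrow> v = u))"
    by (auto simp: hit_once_def fun_eq_iff)
  also have "Measurable.pred (Pi\<^sub>M I (coins A n)) \<dots>"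
    using \<open>finite S\<close> finite_bool_lists
    by (intro pred_intros_finite pred_intros_logic) auto
  finally show ?thesis .
qed

section \<open>Averaging over seeds and activated sets\<close>

lemma hit_once_restrict: "hit_once A n t S (restrict \<omega> S) \<longleftrightarrow> hit_once A n t S \<omega>"
  unfolding hit_once_def by (intro bex_cong refl arg_cong [where f = Ex1] ext) auto

text \<open>With \<open>p S\<close> the probability of a hit, a Markov argument gives
  \<open>Suc t * (1 - p S) \<le> max 0 (f n)\<close> for nonempty \<open>S\<close>. In the weighted
  sum over all \<open>S\<close> the weights add up to \<open>harm n\<close>, while the weighted sum
  of the \<open>p S\<close> is at most \<open>2 ^ t\<close>, by integrating the bound for fixed
  seeds.\<close>

lemma harm_mult_le:
  assumes A: "randomized_algorithm A" and f: "solves_wakeup_in_expectation A f" and "0 < n"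
  shows "harm n * (real (Suc t) - max 0 (f n)) \<le> real (Suc t) * 2 ^ t"
proof -
  \<comment> \<open>The locale needs a probability space at every index; those outside \<open>{1..n}\<close> are irrelevant.\<close>
  define M where "M u = coins A n (if u \<in> {1..n} then u else 1)" for u
  interpret C: product_prob_space M "{1..n}"
    unfolding M_def using A \<open>0 < n\<close>
    by (intro product_prob_spaceI) (auto simp: randomized_algorithm_def)
  \<comment> \<open>One space serves all activated sets, so that the sum over \<open>S\<close> can
    be moved inside the integral; the seeds of \<open>S\<close> are a marginal of it.\<close>
  define P where "P = Pi\<^sub>M {1..n} M"
  have PiM: "Pi\<^sub>M S (coins A n) = Pi\<^sub>M S M" if "S \<subseteq> {1..n}" for S
    using that by (intro PiM_cong) (auto simp: M_def)
  interpret P: prob_space P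
    unfolding P_def by (rule prob_space_PiM) (rule C.M.prob_space_axioms)
  define p where "p S = P.prob {\<omega> \<in> space P. hit_once A n t S \<omega>}" for S
  have meas [measurable]: "Measurable.pred P (hit_once A n t S)" if "S \<subseteq> {1..n}" for S
    using measurable_hit_once [OF A that order.refl] by (simp add: PiM P_def)
  have expected: "real (Suc t) * (1 - p S) \<le> max 0 (f n)" if S: "S \<subseteq> {1..n}" "S \<noteq> {}" for S
  proof -
    let ?Q = "Pi\<^sub>M S M"
    have Q: "?Q = distr P ?Q (\<lambda>\<omega>. restrict \<omega> S)"
      unfolding P_def by (rule C.distr_restrict) (use S in auto)
    have restr [measurable]: "(\<lambda>\<omega>. restrict \<omega> S) \<in> P \<rightarrow>\<^sub>M ?Q"
      unfolding P_def using S by (intro measurable_restrict_subset) auto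
    have [measurable]: "Measurable.pred ?Q (hit_once A n t S)"
      using measurable_hit_once [OF A order.refl S(1)] S by (simp add: PiM)
    define E where "E = {\<omega> \<in> space ?Q. \<not> hit_once A n t S \<omega>}"
    have E [measurable]: "E \<in> sets ?Q"
      unfolding E_def by measurable
    have "emeasure ?Q E = emeasure P ((\<lambda>\<omega>. restrict \<omega> S) -` E \<inter> space P)"
      by (subst Q) (rule emeasure_distr [OF restr E])
    also have "(\<lambda>\<omega>. restrict \<omega> S) -` E \<inter> space P = {\<omega> \<in> space P. \<not> hit_once A n t S \<omega>}"
      using measurable_space [OF restr] by (auto simp: E_def hit_once_restrict)
    also have "emeasure P \<dots> = ennreal (1 - p S)"
      using meas [OF S(1)] unfolding p_def P.emeasure_eq_measure
      by (subst P.prob_neg) (auto simp: pred_def Int_absorb2 Collect_restrict)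
    finally have "ennreal (real (Suc t) * (1 - p S)) = (\<integral>\<^sup>+ \<omega>. of_nat (Suc t) * indicator E \<omega> \<partial>?Q)"
      using E by (subst nn_integral_cmult_indicator)
        (simp_all add: ennreal_mult' ennreal_of_nat_eq_real_of_nat del: of_nat_Suc)
    also have "\<dots> \<le> expected_rounds A n S"
      unfolding expected_rounds_def PiM [OF S(1)] using rounds_until_solved_ge [OF S(1)]
      by (intro nn_integral_mono) (auto simp: E_def indicator_def simp del: of_nat_Suc)
    also have "\<dots> \<le> ennreal (f n)"
      using f S by (simp add: solves_wakeup_in_expectation_def)
    \<comment> \<open>\<open>ennreal\<close> sends a negative \<open>f n\<close> to 0, hence the
      \<open>max\<close>.\<close>
    also have "\<dots> = ennreal (max 0 (f n))"
      by (simp add: max_def ennreal_neg)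
    finally show ?thesis
      by (subst (asm) ennreal_le_iff) auto
  qed
  have int: "integrable P (\<lambda>\<omega>. of_bool (hit_once A n t S \<omega>) :: real)" if "S \<in> Pow {1..n}" for S
  proof (rule P.integrable_const_bound [where B = 1])
    have [measurable]: "Measurable.pred P (hit_once A n t S)"
      using that by (intro meas) auto
    show "(\<lambda>\<omega>. of_bool (hit_once A n t S \<omega>) :: real) \<in> borel_measurable P"
      unfolding of_bool_def by measurable
  qed simp
  have "(\<Sum>S\<in>Pow {1..n}. subset_weight n S * p S) =
      (\<Sum>S\<in>Pow {1..n}. subset_weight n S * (\<integral>\<omega>. of_bool (hit_once A n t S \<omega>) \<partial>P))"
  proof (intro sum.cong refl arg_cong2 [where f = "(*)"])
    fix S assume "S \<in> Pow {1..n}"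
    have "{\<omega> \<in> space P. hit_once A n t S \<omega>} \<inter> space P = {\<omega> \<in> space P. hit_once A n t S \<omega>}"
      by auto
    then have "p S = (\<integral>\<omega>. indicator {\<omega> \<in> space P. hit_once A n t S \<omega>} \<omega> \<partial>P)"
      by (simp add: p_def)
    also have "\<dots> = (\<integral>\<omega>. of_bool (hit_once A n t S \<omega>) \<partial>P)"
      by (intro Bochner_Integration.integral_cong) (auto simp: indicator_def)
    finally show "p S = (\<integral>\<omega>. of_bool (hit_once A n t S \<omega>) \<partial>P)" .
  qed
  also have "\<dots> = (\<integral>\<omega>. (\<Sum>S\<in>Pow {1..n}. subset_weight n S * of_bool (hit_once A n t S \<omega>)) \<partial>P)"
    using int by (subst Bochner_Integration.integral_sum) auto
  also have "\<dots> \<le> (\<integral>\<omega>. 2 ^ t \<partial>P)"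
    using int by (intro integral_mono sum_subset_weight_hit_once_le
        Bochner_Integration.integrable_sum integrable_mult_right) auto
  also have "\<dots> = 2 ^ t"
    by (simp add: P.prob_space)
  finally have p: "(\<Sum>S\<in>Pow {1..n}. subset_weight n S * p S) \<le> 2 ^ t" .
  have "harm n * (real (Suc t) - max 0 (f n)) =
      (\<Sum>S\<in>Pow {1..n}. subset_weight n S * (real (Suc t) - max 0 (f n)))"
    using sum_subset_weight [of "{1..n}"] by (simp flip: sum_distrib_right)
  also have "\<dots> \<le> (\<Sum>S\<in>Pow {1..n}. subset_weight n S * (real (Suc t) * p S))"
  proof (intro sum_mono)
    fix S assume S: "S \<in> Pow {1..n}"
    show "subset_weight n S * (real (Suc t) - max 0 (f n)) \<le>
        subset_weight n S * (real (Suc t) * p S)"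
    \<comment> \<open>\<open>expected\<close> covers nonempty sets only, and the empty set has
      weight 0.\<close>
    proof (cases "S = {}")
      case False
      then show ?thesis
        using expected [of S] S
        by (intro mult_left_mono) (auto simp: subset_weight_nonneg algebra_simps)
    qed (simp add: subset_weight_def)
  qed
  also have "\<dots> = real (Suc t) * (\<Sum>S\<in>Pow {1..n}. subset_weight n S * p S)"
    by (simp add: sum_distrib_left mult_ac)
  also have "\<dots> \<le> real (Suc t) * 2 ^ t"
    using p by (intro mult_left_mono) auto
  finally show ?thesis .
qed

section \<open>The doubly logarithmic bound\<close>

theorem theorem6p2:
  fixes A :: "('r, 'm) radio_algorithm" and f :: "nat \<Rightarrow> real"
  assumes "randomized_algorithm A"
    and "solves_wakeup_in_expectation A f"
  shows "f \<in> \<Omega>(\<lambda>n. log 2 (log 2 (real n)))"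
proof -
  have bound: "(log 2 (ln (real n)) - 1) / 2 \<le> max 0 (f n)" if n: "1 < log 2 (ln (real n))" "3 < n" for n
  proof -
    \<comment> \<open>This is the largest \<open>t\<close> with
      \<open>2 * 2 ^ t \<le> ln (real n)\<close>, so that \<open>2 ^ t\<close> is at most half of
      \<open>harm n\<close>. The assumption \<open>1 < log 2 (ln (real n))\<close> keeps
      \<open>nat\<close> from truncating.\<close>
    define t where "t = nat (\<lfloor>log 2 (ln (real n))\<rfloor> - 1)"
    have t: "real t + 1 = of_int \<lfloor>log 2 (ln (real n))\<rfloor>"
      using n by (simp add: t_def of_nat_nat le_floor_iff)
    then have t_le: "real t + 1 \<le> log 2 (ln (real n))" and t_ge: "log 2 (ln (real n)) - 1 \<le> real t + 1"
      by linarith+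
    have "0 < ln (real n)"
      using n by simp
    have "2 * 2 ^ t = 2 powr (real t + 1)"
      by (simp add: powr_add powr_realpow)
    also have "\<dots> \<le> ln (real n)"
      using t_le \<open>0 < ln (real n)\<close> by (simp add: le_log_iff)
    also have "\<dots> \<le> ln (real n + 1)"
      using n by simp
    also have "\<dots> \<le> harm n"
      by (rule ln_le_harm)
    finally have harm: "2 * 2 ^ t \<le> (harm n :: real)" .
    then have "harm n > (0 :: real)"
      by (smt (verit) zero_less_power)
    have "harm n * (real (Suc t) - max 0 (f n)) \<le> real (Suc t) * 2 ^ t"
      using n by (intro harm_mult_le [OF assms]) auto
    also have "\<dots> \<le> real (Suc t) * (harm n / 2)"
      using harm by (intro mult_left_mono) auto
    also have "\<dots> = harm n * (real (Suc t) / 2)"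
      by simp
    finally have "real (Suc t) - max 0 (f n) \<le> real (Suc t) / 2"
      using \<open>harm n > 0\<close> by (simp only: mult_le_cancel_left_pos)
    then show ?thesis
      using t_ge by simp
  qed
  \<comment> \<open>Replacing \<open>ln\<close> by \<open>log 2\<close> shifts the outer logarithm
    by a constant; lowering the factor \<open>1 / 2\<close> to \<open>1 / 4\<close> absorbs this
    shift and the \<open>- 1\<close>. Positivity of the iterated logarithm turns
    \<open>max 0 (f n)\<close> into \<open>f n\<close>.\<close>
  have "\<forall>\<^sub>F n in sequentially. 1 < log 2 (ln (real n))"
    "\<forall>\<^sub>F n in sequentially. 0 < log 2 (log 2 (real n))"
    "\<forall>\<^sub>F n in sequentially. log 2 (log 2 (real n)) / 4 \<le> (log 2 (ln (real n)) - 1) / 2"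
    by real_asymp+
  then have "\<forall>\<^sub>F n in sequentially. norm (f n) \<ge> 1 / 4 * norm (log 2 (log 2 (real n)))"
    using eventually_gt_at_top [of 3]
  proof eventually_elim
    case (elim n)
    then show ?case
      using bound [of n] by (auto simp: max_def split: if_splits)
  qed
  then show ?thesis
    by (intro landau_omega.bigI [where c = "1 / 4"]) auto
qed

end
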